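(* Let $n\ge3$ and $q\ge1$ be integers, and let $\mathcal W_n$ be the wheel graph with vertex set $U\cup\{v\}$, $U=\{x_1,\ldots,x_n\}$. Let $F\subseteq V(\mathcal W_n)$ and write $F=F'$ or $F=F'\cup\{v\}$ with $F'\subseteq U$. Then $F\in\Delta_q(\mathcal W_n)$ if and only if one of the following holds: (a) $v\notin F$ and $\nu(\mathcal C_n[F'])<q$; (b) $v\in F$, and $\nu(\mathcal C_n[F'])<q$ if $\mathcal C_n[F']$ has a perfect matching, while $\nu(\mathcal C_n[F'])<q-1$ if it does not.
   Context: The wheel graph $\mathcal W_n$ is obtained from the cycle $\mathcal C_n$ on $U=\{x_1,\ldots,x_n\}$ by adding a vertex $v$ adjacent to all of $U$. For a finite simple graph $X$, $\nu(X)$ is the matching number (maximum number of pairwise vertex-disjoint edges), $X[F]$ is the subgraph induced on $F\subseteq V(X)$, and $\Delta_q(X):=\{F\subseteq V(X):\nu(X[F])<q\}$. A graph has a perfect matching if some matching covers all of its vertices; the empty graph has matching number $0$ and has a perfect matching. *)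

theory Defs
  imports Main
begin

record 'a graph =
  verts :: "'a set"
  edges :: "'a set set"

definition finite_simple_graph :: "'a graph \<Rightarrow> bool" where
  "finite_simple_graph G \<longleftrightarrow>
     finite (verts G) \<and> (\<forall>e \<in> edges G. e \<subseteq> verts G \<and> card e = 2)"

definition induced_subgraph :: "'a graph \<Rightarrow> 'a set \<Rightarrow> 'a graph" where
  "induced_subgraph G F = \<lparr>verts = verts G \<inter> F, edges = {e \<in> edges G. e \<subseteq> F}\<rparr>"

definition matching :: "'a graph \<Rightarrow> 'a set set \<Rightarrow> bool" where
  "matching G M \<longleftrightarrow> M \<subseteq> edges G \<and> pairwise disjnt M"

text \<open>The maximum is meaningful for finite graphs; the empty matching makes the set nonempty.\<close>
definition matching_number :: "'a graph \<Rightarrow> nat" where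
  "matching_number G = Max {card M | M. matching G M}"

definition has_perfect_matching :: "'a graph \<Rightarrow> bool" where
  "has_perfect_matching G \<longleftrightarrow> (\<exists>M. matching G M \<and> \<Union> M = verts G)"

definition Delta :: "nat \<Rightarrow> 'a graph \<Rightarrow> 'a set set" where
  "Delta q G = {F. F \<subseteq> verts G \<and> matching_number (induced_subgraph G F) < q}"

text \<open>
  The vertices of the cycle are \<open>x 1, \<dots>, x n\<close>, in this cyclic order. The two graphs
  below are the intended ones when \<open>n \<ge> 3\<close>, \<open>x\<close> is injective on \<open>{1..n}\<close> and the hub \<open>v\<close>
  is not among the \<open>x i\<close>.
\<close>
definition cycle_graph :: "nat \<Rightarrow> (nat \<Rightarrow> 'a) \<Rightarrow> 'a graph" where
  "cycle_graph n x =
     \<lparr>verts = x ` {1..n}, edges = insert {x n, x 1} {{x i, x (i + 1)} | i. 1 \<le> i \<and> i < n}\<rparr>"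

definition wheel_graph :: "nat \<Rightarrow> (nat \<Rightarrow> 'a) \<Rightarrow> 'a \<Rightarrow> 'a graph" where
  "wheel_graph n x v =
     \<lparr>verts = insert v (verts (cycle_graph n x)),
      edges = edges (cycle_graph n x) \<union> {{v, u} | u. u \<in> verts (cycle_graph n x)}\<rparr>"

lemma finite_simple_graph_cycle:
  assumes "n \<ge> 3" and "inj_on x {1..n}"
  shows "finite_simple_graph (cycle_graph n x)"
proof -
  have "x n \<noteq> x 1" using inj_onD[OF assms(2), of n 1] assms(1) by auto
  moreover have "x i \<noteq> x (Suc i)" if "1 \<le> i" "i < n" for i
    using inj_onD[OF assms(2), of i "Suc i"] that by auto
  ultimately show ?thesis
    using assms(1) by (auto simp: finite_simple_graph_def cycle_graph_def card_insert_if)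
qed

lemma finite_simple_graph_wheel:
  assumes "n \<ge> 3" and "inj_on x {1..n}" and "v \<notin> x ` {1..n}"
  shows "finite_simple_graph (wheel_graph n x v)"
proof -
  have "verts (cycle_graph n x) = x ` {1..n}" by (simp add: cycle_graph_def)
  then show ?thesis
    using finite_simple_graph_cycle[OF assms(1,2)] assms(3)
    by (auto simp: finite_simple_graph_def wheel_graph_def card_insert_if)
qed

end

theory Submission
  imports Defs
begin

text \<open>
  The wheel is the cone over the cycle: every rim vertex is adjacent to the hub. The cycle itself
  matters only as a finite simple graph, because the statement reduces to how the matching number
  of an arbitrary finite simple graph \<open>G\<close> changes when a vertex adjacent to everything is added.

  Removing the edge at the apex turns a matching of the cone into a matching of \<open>G\<close>, so the
  matching number grows by at most one. If \<open>G\<close> has a perfect matching, then \<open>G\<close> has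
  \<open>2 * \<nu>(G)\<close> vertices, and \<open>\<nu>(G) + 1\<close> disjoint edges would need one vertex more than the cone
  has: the number stays the same (\<open>matching_number_cone_perfect\<close>). Otherwise a maximum matching
  of \<open>G\<close> misses some vertex, and the edge from that vertex to the apex can be added: the number
  grows by exactly one (\<open>matching_number_cone_not_perfect\<close>).

  Induced subgraphs of a cone are cones over induced subgraphs if they contain the apex, and
  induced subgraphs of the base otherwise, so these two cases give the criterion for the wheel.
\<close>

section \<open>Matchings in finite simple graphs\<close>

lemma finite_edges:
  assumes "finite_simple_graph G"
  shows "finite (edges G)"
proof (rule finite_subset)
  show "edges G \<subseteq> Pow (verts G)" using assms by (auto simp: finite_simple_graph_def)
  show "finite (Pow (verts G))" using assms by (simp add: finite_simple_graph_def)
qed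

lemma finite_matching_cards:
  assumes "finite_simple_graph G"
  shows "finite {card M | M. matching G M}"
proof (rule finite_subset)
  show "{card M | M. matching G M} \<subseteq> card ` Pow (edges G)" by (auto simp: matching_def)
  show "finite (card ` Pow (edges G))" using finite_edges[OF assms] by simp
qed

lemma matching_card_le:
  assumes "finite_simple_graph G" and "matching G M"
  shows "card M \<le> matching_number G"
  unfolding matching_number_def using assms by (intro Max_ge finite_matching_cards) auto

lemma obtain_maximum_matching:
  assumes "finite_simple_graph G"
  obtains M where "matching G M" and "card M = matching_number G"
proof -
  have "matching G {}" by (simp add: matching_def)
  then have "{card M | M. matching G M} \<noteq> {}" by blast
  from Max_in[OF finite_matching_cards[OF assms] this] show ?thesis
    unfolding matching_number_def[symmetric] using that by auto
qed

lemma finite_matching: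
  assumes "finite_simple_graph G" and "matching G M"
  shows "finite M"
  using assms finite_edges finite_subset by (auto simp: matching_def)

lemma matching_covers_subset:
  assumes "finite_simple_graph G" and "matching G M"
  shows "\<Union> M \<subseteq> verts G"
  using assms by (auto simp: matching_def finite_simple_graph_def)

lemma card_covered_by_matching:
  assumes "finite_simple_graph G" and "matching G M"
  shows "card (\<Union> M) = 2 * card M"
proof -
  have edge: "card e = 2" if "e \<in> M" for e
    using assms that by (auto simp: matching_def finite_simple_graph_def)
  have "card (\<Union> M) = sum card M"
  proof (rule card_Union_disjoint)
    show "pairwise disjnt M" using assms(2) by (simp add: matching_def)
    show "finite e" if "e \<in> M" for e using edge[OF that] card.infinite by fastforce
  qed
  also have "\<dots> = 2 * card M" using edge by simp
  finally show ?thesis .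
qed

lemma matching_card_bound:
  assumes "finite_simple_graph G" and "matching G M"
  shows "2 * card M \<le> card (verts G)"
  using card_mono[OF _ matching_covers_subset[OF assms]] card_covered_by_matching[OF assms] assms(1)
  by (simp add: finite_simple_graph_def)

lemma finite_simple_graph_induced:
  "finite_simple_graph G \<Longrightarrow> finite_simple_graph (induced_subgraph G F)"
  by (auto simp: finite_simple_graph_def induced_subgraph_def)

section \<open>The matching number of a cone\<close>

definition cone :: "'a graph \<Rightarrow> 'a \<Rightarrow> 'a graph" where
  "cone G v =
     \<lparr>verts = insert v (verts G), edges = edges G \<union> {{v, u} | u. u \<in> verts G}\<rparr>"

lemma finite_simple_graph_cone:
  assumes "finite_simple_graph G" and "v \<notin> verts G"
  shows "finite_simple_graph (cone G v)"
  using assms by (auto simp: finite_simple_graph_def cone_def card_insert_if)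

lemma matching_cone:
  "matching G M \<Longrightarrow> matching (cone G v) M"
  by (auto simp: matching_def cone_def)

lemma matching_number_le_cone:
  assumes "finite_simple_graph G" and "v \<notin> verts G"
  shows "matching_number G \<le> matching_number (cone G v)"
  using obtain_maximum_matching[OF assms(1)]
    matching_card_le[OF finite_simple_graph_cone[OF assms] matching_cone]
  by metis

text \<open>Two edges of a matching cannot share the apex, so deleting the edges at the apex costs at
  most one edge.\<close>
lemma matching_number_cone_le:
  assumes "finite_simple_graph G" and "v \<notin> verts G"
  shows "matching_number (cone G v) \<le> Suc (matching_number G)"
proof -
  note fin = finite_simple_graph_cone[OF assms]
  obtain M where M: "matching (cone G v) M" "card M = matching_number (cone G v)"
    using obtain_maximum_matching[OF fin] .
  let ?A = "{e \<in> M. v \<in> e}" and ?B = "{e \<in> M. v \<notin> e}"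
  have finM: "finite M" using finite_matching[OF fin M(1)] .
  have "e = e'" if "e \<in> ?A" "e' \<in> ?A" for e e'
    using that M(1) by (auto simp: matching_def pairwise_def disjnt_def)
  then have "card ?A \<le> 1" using finM by (simp add: card_le_Suc0_iff_eq)
  moreover have "matching G ?B"
    using M(1) by (auto simp: matching_def cone_def intro: pairwise_subset)
  then have "card ?B \<le> matching_number G" by (rule matching_card_le[OF assms(1)])
  moreover have "card M = card (?A \<union> ?B)" by (rule arg_cong[where f = card]) auto
  then have "card M \<le> card ?A + card ?B" using card_Un_le[of ?A ?B] by simp
  ultimately show ?thesis using M(2) by simp
qed

text \<open>The cone has an odd number of vertices, one more than a perfect matching of the base covers;
  this leaves no room for a further edge.\<close>
lemma matching_number_cone_perfect:
  assumes "finite_simple_graph G" and "v \<notin> verts G" and "has_perfect_matching G"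
  shows "matching_number (cone G v) = matching_number G"
proof (rule antisym)
  note fin = finite_simple_graph_cone[OF assms(1,2)]
  obtain P where P: "matching G P" "\<Union> P = verts G"
    using assms(3) by (auto simp: has_perfect_matching_def)
  have "card (verts G) = 2 * card P" using card_covered_by_matching[OF assms(1) P(1)] P(2) by simp
  moreover have "card (verts (cone G v)) = Suc (card (verts G))"
    using assms(1,2) by (simp add: cone_def finite_simple_graph_def)
  moreover obtain M where M: "matching (cone G v) M" "card M = matching_number (cone G v)"
    using obtain_maximum_matching[OF fin] .
  ultimately have "2 * matching_number (cone G v) \<le> Suc (2 * card P)"
    using matching_card_bound[OF fin M(1)] by simp
  then show "matching_number (cone G v) \<le> matching_number G"
    using matching_card_le[OF assms(1) P(1)] by simp
  show "matching_number G \<le> matching_number (cone G v)"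
    using matching_number_le_cone[OF assms(1,2)] .
qed

text \<open>A maximum matching of the base leaves a vertex uncovered, and that vertex can be matched to
  the apex.\<close>
lemma matching_number_cone_not_perfect:
  assumes "finite_simple_graph G" and "v \<notin> verts G" and "\<not> has_perfect_matching G"
  shows "matching_number (cone G v) = Suc (matching_number G)"
proof (rule antisym)
  show "matching_number (cone G v) \<le> Suc (matching_number G)"
    using matching_number_cone_le[OF assms(1,2)] .
  obtain M where M: "matching G M" "card M = matching_number G"
    using obtain_maximum_matching[OF assms(1)] .
  have sub: "\<Union> M \<subseteq> verts G" using matching_covers_subset[OF assms(1) M(1)] .
  moreover have "\<Union> M \<noteq> verts G" using assms(3) M(1) by (auto simp: has_perfect_matching_def)
  ultimately obtain u where u: "u \<in> verts G" "u \<notin> \<Union> M" by blast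
  have avoid: "{v, u} \<inter> e = {}" if "e \<in> M" for e using that sub u(2) assms(2) by auto
  then have "{v, u} \<notin> M" by blast
  moreover have "matching (cone G v) (insert {v, u} M)"
    using M(1) u(1) avoid
    by (auto simp: matching_def cone_def pairwise_insert disjnt_def)
  ultimately show "Suc (matching_number G) \<le> matching_number (cone G v)"
    using matching_card_le[OF finite_simple_graph_cone[OF assms(1,2)]]
      finite_matching[OF assms(1) M(1)] M(2)
    by fastforce
qed

section \<open>Induced subgraphs of the wheel\<close>

lemma wheel_graph_eq_cone:
  "wheel_graph n x v = cone (cycle_graph n x) v"
  by (simp add: wheel_graph_def cone_def)

lemma induced_subgraph_cone_base:
  assumes "v \<notin> F"
  shows "induced_subgraph (cone G v) F = induced_subgraph G F"
  using assms by (auto simp: induced_subgraph_def cone_def)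

lemma induced_subgraph_cone_apex:
  assumes "finite_simple_graph G" and "v \<notin> verts G"
  shows "induced_subgraph (cone G v) (insert v F) = cone (induced_subgraph G F) v"
proof -
  have "e \<subseteq> insert v F \<longleftrightarrow> e \<subseteq> F" if "e \<in> edges G" for e
    using that assms by (auto simp: finite_simple_graph_def)
  then show ?thesis using assms(2) by (auto simp: induced_subgraph_def cone_def)
qed

theorem corollary4p3:
  fixes n q :: nat and x :: "nat \<Rightarrow> 'a" and v :: 'a and U F F' :: "'a set"
  assumes "n \<ge> 3" and "q \<ge> 1"
    and "U = x ` {1..n}" and "inj_on x {1..n}" and "v \<notin> U"
    and "F \<subseteq> verts (wheel_graph n x v)"
    and "F' \<subseteq> U" and "F = F' \<or> F = F' \<union> {v}"
  shows "F \<in> Delta q (wheel_graph n x v) \<longleftrightarrow>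
      (v \<notin> F \<and> matching_number (induced_subgraph (cycle_graph n x) F') < q)
    \<or> (v \<in> F \<and>
        (has_perfect_matching (induced_subgraph (cycle_graph n x) F') \<longrightarrow>
           matching_number (induced_subgraph (cycle_graph n x) F') < q) \<and>
        (\<not> has_perfect_matching (induced_subgraph (cycle_graph n x) F') \<longrightarrow>
           matching_number (induced_subgraph (cycle_graph n x) F') < q - 1))"
proof -
  let ?C = "cycle_graph n x"
  let ?H = "induced_subgraph ?C F'"
  have C: "finite_simple_graph ?C" using finite_simple_graph_cycle assms(1,4) .
  have H: "finite_simple_graph ?H" using finite_simple_graph_induced[OF C] .
  have vC: "v \<notin> verts ?C" using assms(3,5) by (simp add: cycle_graph_def)
  then have vH: "v \<notin> verts ?H" by (simp add: induced_subgraph_def)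
  have vF': "v \<notin> F'" using assms(5,7) by blast
  have Delta: "F \<in> Delta q (wheel_graph n x v)
      \<longleftrightarrow> matching_number (induced_subgraph (cone ?C v) F) < q"
    using assms(6) by (simp add: Delta_def wheel_graph_eq_cone)
  show ?thesis
  proof (cases "v \<in> F")
    case False
    then have "F = F'" using assms(8) by blast
    then show ?thesis using False Delta induced_subgraph_cone_base[OF vF', of ?C] by simp
  next
    case True
    then have "F = insert v F'" using assms(8) vF' by blast
    then have "F \<in> Delta q (wheel_graph n x v) \<longleftrightarrow> matching_number (cone ?H v) < q"
      using Delta induced_subgraph_cone_apex[OF C vC] by simp
    then show ?thesis
      using True matching_number_cone_perfect[OF H vH] matching_number_cone_not_perfect[OF H vH]
      by (cases "has_perfect_matching ?H") auto
  qed
qed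

end
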